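(* Let $\mathcal F$ be a field family with respect to $G$ and let $F=k((\mathcal F))$ be the corresponding Rayner field. Then $F$ has the canonical first lifting property if and only if $\mathcal F$ is stable under $o\text{-}\mathrm{Aut}\,G$, i.e. $A\in\mathcal F$ and $\tau\in o\text{-}\mathrm{Aut}\,G$ imply $\tau(A)\in\mathcal F$.
   Context: Let $k$ be a field and $(G,+,<)$ a non-trivial totally ordered abelian group. $\mathbb K=k((G))$ is the field of all formal series $a=\sum_{g\in G}a_gt^g$ ($a_g\in k$) whose support $\operatorname{supp}a=\{g:a_g\neq 0\}$ is well ordered, with termwise addition and convolution product. $k(G)\subseteq\mathbb K$ is the fraction field of the group ring $k[G]$. A Hahn field is a field $K$ with $k(G)\subseteq K\subseteq\mathbb K$. A family $\mathcal F\neq\emptyset$ of subsets of $G$ is a field family (with respect to $G$) if: (R1) the elements of $\mathcal F$ are well ordered subsets of $G$; (R2) the union of the elements of $\mathcal F$ generates $G$ as a group; (R3) $A,B\in\mathcal F\Rightarrow A\cup B\in\mathcal F$; (R4) $A\in\mathcal F,\ B\subset A\Rightarrow B\in\mathcal F$; (R5) $A\in\mathcal F,\ g\in G\Rightarrow A+g\in\mathcal F$; (R6) if $A\in\mathcal F$ and $A\subseteq G^{\ge0}$, then the set of all finite sums of elements of $A$ belongs to $\mathcal F$. For a field family $\mathcal F$, the set $k((\mathcal F))=\{a\in\mathbb K:\operatorname{supp}a\in\mathcal F\}$ is a subfield of $\mathbb K$ (known theorem of Rayner) and is a Hahn field; such fields are called Rayner fields. $\mathrm{Aut}\,k$ is the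 group of field automorphisms of $k$ and $o\text{-}\mathrm{Aut}\,G$ the group of order preserving automorphisms of $G$. For $(\rho,\tau)\in\mathrm{Aut}\,k\times o\text{-}\mathrm{Aut}\,G$ the canonical lift is the automorphism $\widetilde{\rho\tau}$ of $\mathbb K$ given by $\widetilde{\rho\tau}(\sum a_gt^g)=\sum\rho(a_g)t^{\tau(g)}$. A Hahn field $K$ has the canonical first lifting property if $\widetilde{\rho\tau}(K)=K$ for all $(\rho,\tau)\in\mathrm{Aut}\,k\times o\text{-}\mathrm{Aut}\,G$. *)

theory Defs
  imports "HOL-Computational_Algebra.Group_Closure"
begin

definition well_ordered :: "'g::linorder set \<Rightarrow> bool" where
  "well_ordered A \<longleftrightarrow> (\<forall>B\<subseteq>A. B \<noteq> {} \<longrightarrow> (\<exists>m\<in>B. \<forall>b\<in>B. m \<le> b))"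

lemma well_ordered_least:
  assumes "well_ordered A" "B \<subseteq> A" "B \<noteq> {}"
  shows "\<exists>m\<in>B. \<forall>b\<in>B. m \<le> b"
  using assms by (simp add: well_ordered_def)

lemma well_ordered_subset: "well_ordered A \<Longrightarrow> B \<subseteq> A \<Longrightarrow> well_ordered B"
  unfolding well_ordered_def by (meson order_trans)

lemma well_ordered_empty [simp]: "well_ordered {}"
  by (simp add: well_ordered_def)

lemma well_ordered_singleton [simp]: "well_ordered {g}"
  by (auto simp: well_ordered_def subset_singleton_iff)

lemma well_ordered_Un:
  assumes "well_ordered A" "well_ordered B"
  shows "well_ordered (A \<union> B)"
  unfolding well_ordered_def
proof (intro allI impI)
  fix C assume C: "C \<subseteq> A \<union> B" "C \<noteq> {}"
  show "\<exists>m\<in>C. \<forall>b\<in>C. m \<le> b"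
  proof (cases "C \<inter> A = {} \<or> C \<inter> B = {}")
    case True
    then consider "C \<subseteq> A" | "C \<subseteq> B" using C(1) by blast
    then show ?thesis
      by cases (use C(2) assms in \<open>simp_all add: well_ordered_def\<close>)
  next
    case False
    obtain m where m: "m \<in> C \<inter> A" "\<forall>b\<in>C \<inter> A. m \<le> b"
      using well_ordered_least[OF assms(1), of "C \<inter> A"] False by blast
    obtain n where n: "n \<in> C \<inter> B" "\<forall>b\<in>C \<inter> B. n \<le> b"
      using well_ordered_least[OF assms(2), of "C \<inter> B"] False by blast
    show ?thesis
    proof (rule bexI[of _ "min m n"])
      show "\<forall>b\<in>C. min m n \<le> b"
      proof
        fix b assume b: "b \<in> C"
        then consider "b \<in> A" | "b \<in> B" using C(1) by blast
        then show "min m n \<le> b"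
          by cases (use b m(2) n(2) in \<open>auto intro: min.coboundedI1 min.coboundedI2\<close>)
      qed
      show "min m n \<in> C" using m(1) n(1) by (auto simp: min_def)
    qed
  qed
qed

lemma well_ordered_wf:
  assumes "well_ordered A"
  shows "wf {(x, y). x \<in> A \<and> y \<in> A \<and> x < y}"
proof (rule wfI_min)
  fix x :: 'a and Q assume "x \<in> Q"
  show "\<exists>z\<in>Q. \<forall>y. (y, z) \<in> {(x, y). x \<in> A \<and> y \<in> A \<and> x < y} \<longrightarrow> y \<notin> Q"
  proof (cases "Q \<inter> A = {}")
    case True
    then show ?thesis using \<open>x \<in> Q\<close> by blast
  next
    case False
    obtain m where "m \<in> Q \<inter> A" "\<forall>b\<in>Q \<inter> A. m \<le> b"
      using well_ordered_least[OF assms, of "Q \<inter> A"] False by blast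
    then show ?thesis by (intro bexI[of _ m]) (auto dest: leD)
  qed
qed

lemma well_ordered_sumset:
  fixes A B :: "'g::linordered_ab_group_add set"
  assumes "well_ordered A" "well_ordered B"
  shows "well_ordered {a + b |a b. a \<in> A \<and> b \<in> B}"
  unfolding well_ordered_def
proof (intro allI impI)
  fix C assume C: "C \<subseteq> {a + b |a b. a \<in> A \<and> b \<in> B}" "C \<noteq> {}"
  have step: "\<forall>a\<in>A. a + b \<in> C \<longrightarrow>
      (\<forall>a'\<in>A. \<forall>b'\<in>B. a' + b' \<in> C \<longrightarrow> a' + b' < a + b \<longrightarrow> a \<le> a') \<longrightarrow>
      (\<exists>m\<in>C. \<forall>c\<in>C. m \<le> c)" if "b \<in> B" for b
    using well_ordered_wf[OF assms(2)] that
  proof (induction b rule: wf_induct_rule)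
    case (less b)
    show ?case
    proof (intro ballI impI)
      fix a assume a: "a \<in> A" "a + b \<in> C"
        and min: "\<forall>a'\<in>A. \<forall>b'\<in>B. a' + b' \<in> C \<longrightarrow> a' + b' < a + b \<longrightarrow> a \<le> a'"
      define Q where "Q = {a' \<in> A. \<exists>b'\<in>B. a' + b' \<in> C \<and> a' + b' < a + b}"
      show "\<exists>m\<in>C. \<forall>c\<in>C. m \<le> c"
      proof (cases "Q = {}")
        case True
        have "a + b \<le> c" if c: "c \<in> C" for c
        proof (rule ccontr)
          assume "\<not> a + b \<le> c"
          moreover obtain a' b' where "a' \<in> A" "b' \<in> B" "c = a' + b'" using C(1) c by blast
          ultimately have "a' \<in> Q" using c unfolding Q_def by auto
          then show False using True by blast
        qed
        then show ?thesis using a by blast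
      next
        case False
        have "Q \<subseteq> A" unfolding Q_def by blast
        obtain a' where a': "a' \<in> Q" "\<forall>q\<in>Q. a' \<le> q"
          using well_ordered_least[OF assms(1) \<open>Q \<subseteq> A\<close> False] by blast
        then obtain b' where b': "b' \<in> B" "a' + b' \<in> C" "a' + b' < a + b" "a' \<in> A"
          unfolding Q_def by blast
        have "a \<le> a'" using min b' by blast
        have "b' < b"
        proof (rule ccontr)
          assume "\<not> b' < b"
          then have "a + b \<le> a' + b'" using \<open>a \<le> a'\<close> by (intro add_mono) auto
          then show False using b' by simp
        qed
        have "\<forall>a''\<in>A. \<forall>b''\<in>B. a'' + b'' \<in> C \<longrightarrow> a'' + b'' < a' + b' \<longrightarrow> a' \<le> a''"
          using a'(2) b'(3) less_trans unfolding Q_def by blast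
        moreover have "(b', b) \<in> {(x, y). x \<in> B \<and> y \<in> B \<and> x < y}"
          using \<open>b' < b\<close> b'(1) less.prems by blast
        ultimately show ?thesis
          using less.IH[rule_format, of b' a'] b' by blast
      qed
    qed
  qed
  define P where "P = {a \<in> A. \<exists>b\<in>B. a + b \<in> C}"
  have "P \<noteq> {}" "P \<subseteq> A" using C unfolding P_def by blast+
  then obtain a where a: "a \<in> P" "\<forall>p\<in>P. a \<le> p"
    using well_ordered_least[OF assms(1), of P] by blast
  then obtain b where "b \<in> B" "a + b \<in> C" "a \<in> A" unfolding P_def by blast
  moreover have "\<forall>a'\<in>A. \<forall>b'\<in>B. a' + b' \<in> C \<longrightarrow> a' + b' < a + b \<longrightarrow> a \<le> a'"
    using a(2) unfolding P_def by blast
  ultimately show "\<exists>m\<in>C. \<forall>c\<in>C. m \<le> c" using step[rule_format, of b a] by blast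
qed

lemma finite_if_well_ordered_both_ways:
  fixes X :: "'g::linorder set"
  assumes wo: "well_ordered X"
    and max: "\<And>Y. Y \<subseteq> X \<Longrightarrow> Y \<noteq> {} \<Longrightarrow> \<exists>m\<in>Y. \<forall>y\<in>Y. y \<le> m"
  shows "finite X"
proof -
  have fin: "finite Y" if Y: "Y \<subseteq> X" "\<And>x. x \<in> Y \<Longrightarrow> finite {y \<in> Y. y < x}" for Y
  proof (cases "Y = {}")
    case False
    then obtain m where m: "m \<in> Y" "\<forall>y\<in>Y. y \<le> m" using max[OF Y(1) False] by blast
    then have "insert m {y \<in> Y. y < m} = Y" by force
    moreover have "finite (insert m {y \<in> Y. y < m})" using Y(2)[OF m(1)] by simp
    ultimately show ?thesis by simp
  qed simp
  define Y where "Y = {x \<in> X. infinite {y \<in> X. y < x}}"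
  show ?thesis
  proof (cases "Y = {}")
    case True
    then show ?thesis using fin[of X] unfolding Y_def by blast
  next
    case False
    have "Y \<subseteq> X" unfolding Y_def by blast
    obtain x where x: "x \<in> Y" "\<forall>y\<in>Y. x \<le> y"
      using well_ordered_least[OF wo \<open>Y \<subseteq> X\<close> False] by blast
    have "finite {y \<in> X. y < x}"
    proof (rule fin)
      fix z assume z: "z \<in> {y \<in> X. y < x}"
      then have "z \<notin> Y" using x(2) by (auto dest: leD)
      then have "finite {y \<in> X. y < z}" using z unfolding Y_def by blast
      then show "finite {y \<in> {y \<in> X. y < x}. y < z}" by (rule rev_finite_subset) blast
    qed blast
    then show ?thesis using x(1) unfolding Y_def by blast
  qed
qed

lemma finite_decompositions:
  fixes A B :: "'g::linordered_ab_group_add set"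
  assumes "well_ordered A" "well_ordered B"
  shows "finite {h \<in> A. g - h \<in> B}"
proof (rule finite_if_well_ordered_both_ways)
  show "well_ordered {h \<in> A. g - h \<in> B}" using assms(1) by (rule well_ordered_subset) blast
  fix Y assume Y: "Y \<subseteq> {h \<in> A. g - h \<in> B}" "Y \<noteq> {}"
  then obtain m where m: "m \<in> (\<lambda>h. g - h) ` Y" "\<forall>b\<in>(\<lambda>h. g - h) ` Y. m \<le> b"
    using well_ordered_least[OF assms(2), of "(\<lambda>h. g - h) ` Y"] by blast
  then show "\<exists>m\<in>Y. \<forall>y\<in>Y. y \<le> m" by force
qed

text \<open>
  The ordered group \<open>G\<close> is the type \<^typ>\<open>'g::linordered_ab_group_add\<close> and the coefficient
  field is the type \<^typ>\<open>'k::field\<close>; \<open>('g, 'k) hahn\<close> is \<open>k((G))\<close>.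
\<close>

lemma sum_Collect_nonzeroD: "sum f {x. P x} \<noteq> 0 \<Longrightarrow> \<exists>x. P x"
  by (cases "\<exists>x. P x") auto

typedef (overloaded) ('g::linordered_ab_group_add, 'k::zero) hahn =
  "{a :: 'g \<Rightarrow> 'k. well_ordered {g. a g \<noteq> 0}}"
  morphisms coeff Abs_hahn
  by (rule exI[of _ "\<lambda>_. 0"]) simp

setup_lifting type_definition_hahn

definition supp :: "('g::linordered_ab_group_add, 'k::zero) hahn \<Rightarrow> 'g set" where
  "supp a = {g. coeff a g \<noteq> 0}"

lemma hahn_eqI: "(\<And>g. coeff a g = coeff b g) \<Longrightarrow> a = b"
  by (metis coeff_inject ext)

lemma well_ordered_supp [simp]: "well_ordered (supp a)"
  using coeff[of a] unfolding supp_def by simp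

lemma well_ordered_coeff [simp]: "well_ordered {g. coeff a g \<noteq> 0}"
  using coeff[of a] by simp

instantiation hahn :: (linordered_ab_group_add, comm_ring_1) comm_ring_1
begin

lift_definition zero_hahn :: "('a, 'b) hahn" is "\<lambda>_. 0" by simp

lift_definition one_hahn :: "('a, 'b) hahn" is "\<lambda>g. if g = 0 then 1 else 0" by simp

lift_definition plus_hahn :: "('a, 'b) hahn \<Rightarrow> ('a, 'b) hahn \<Rightarrow> ('a, 'b) hahn"
  is "\<lambda>a b g. a g + b g"
  by (erule (1) well_ordered_subset[OF well_ordered_Un]) auto

lift_definition uminus_hahn :: "('a, 'b) hahn \<Rightarrow> ('a, 'b) hahn" is "\<lambda>a g. - a g" by simp

lift_definition minus_hahn :: "('a, 'b) hahn \<Rightarrow> ('a, 'b) hahn \<Rightarrow> ('a, 'b) hahn"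
  is "\<lambda>a b g. a g - b g"
  by (erule (1) well_ordered_subset[OF well_ordered_Un]) auto

text \<open>The index set of the sum is finite by \<open>finite_decompositions\<close>.\<close>

lift_definition times_hahn :: "('a, 'b) hahn \<Rightarrow> ('a, 'b) hahn \<Rightarrow> ('a, 'b) hahn"
  is "\<lambda>a b g. \<Sum>h | a h \<noteq> 0 \<and> b (g - h) \<noteq> 0. a h * b (g - h)"
proof -
  fix a b :: "'a \<Rightarrow> 'b"
  assume wo: "well_ordered {g. a g \<noteq> 0}" "well_ordered {g. b g \<noteq> 0}"
  have "{g. (\<Sum>h | a h \<noteq> 0 \<and> b (g - h) \<noteq> 0. a h * b (g - h)) \<noteq> 0}
      \<subseteq> {x + y |x y. x \<in> {g. a g \<noteq> 0} \<and> y \<in> {g. b g \<noteq> 0}}"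
  proof
    fix g assume "g \<in> {g. (\<Sum>h | a h \<noteq> 0 \<and> b (g - h) \<noteq> 0. a h * b (g - h)) \<noteq> 0}"
    then obtain h where "a h \<noteq> 0" "b (g - h) \<noteq> 0"
      by (auto dest: sum_Collect_nonzeroD)
    moreover have "g = h + (g - h)" by simp
    ultimately show "g \<in> {x + y |x y. x \<in> {g. a g \<noteq> 0} \<and> y \<in> {g. b g \<noteq> 0}}" by blast
  qed
  then show "well_ordered {g. (\<Sum>h | a h \<noteq> 0 \<and> b (g - h) \<noteq> 0. a h * b (g - h)) \<noteq> 0}"
    by (rule well_ordered_subset[OF well_ordered_sumset[OF wo]])
qed

lemma finite_conv: "finite {h. coeff a h \<noteq> 0 \<and> coeff b (g - h) \<noteq> 0}"
  for a b :: "('a, 'b) hahn"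
  using finite_decompositions[OF well_ordered_coeff[of a] well_ordered_coeff[of b], of g] by simp

lemma coeff_times_superset:
  fixes a b :: "('a, 'b) hahn"
  assumes "finite T" "{h. coeff a h \<noteq> 0 \<and> coeff b (g - h) \<noteq> 0} \<subseteq> T"
  shows "coeff (a * b) g = (\<Sum>h\<in>T. coeff a h * coeff b (g - h))"
  unfolding times_hahn.rep_eq
  by (rule sum.mono_neutral_left[OF assms]) auto

instance
proof
  fix a b c :: "('a, 'b) hahn"
  show "a + b + c = a + (b + c)" "a + b = b + a" "0 + a = a" "- a + a = 0" "a - b = a + - b"
    by (transfer; simp add: algebra_simps)+
  show "(0 :: ('a, 'b) hahn) \<noteq> 1"
    by transfer (auto simp: fun_eq_iff)
  show "1 * a = a"
  proof (rule hahn_eqI)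
    fix g
    have "coeff (1 * a) g = (\<Sum>h\<in>{0}. coeff 1 h * coeff a (g - h))"
      by (rule coeff_times_superset) (auto simp: one_hahn.rep_eq split: if_splits)
    then show "coeff (1 * a) g = coeff a g" by (simp add: one_hahn.rep_eq)
  qed
  show "a * b = b * a"
  proof (rule hahn_eqI)
    fix g
    show "coeff (a * b) g = coeff (b * a) g"
      unfolding times_hahn.rep_eq
      by (rule sum.reindex_bij_witness[of _ "\<lambda>h. g - h" "\<lambda>h. g - h"]) (auto simp: mult.commute)
  qed
  show "(a + b) * c = a * c + b * c"
  proof (rule hahn_eqI)
    fix g
    define T where "T = {h. coeff a h \<noteq> 0 \<and> coeff c (g - h) \<noteq> 0} \<union>
      {h. coeff b h \<noteq> 0 \<and> coeff c (g - h) \<noteq> 0}"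
    have T: "finite T" unfolding T_def by (intro finite_UnI finite_conv)
    have "coeff ((a + b) * c) g = (\<Sum>h\<in>T. coeff (a + b) h * coeff c (g - h))"
      by (rule coeff_times_superset[OF T]) (auto simp: T_def plus_hahn.rep_eq)
    moreover have "coeff (a * c) g = (\<Sum>h\<in>T. coeff a h * coeff c (g - h))"
      by (rule coeff_times_superset[OF T]) (auto simp: T_def)
    moreover have "coeff (b * c) g = (\<Sum>h\<in>T. coeff b h * coeff c (g - h))"
      by (rule coeff_times_superset[OF T]) (auto simp: T_def)
    ultimately show "coeff ((a + b) * c) g = coeff (a * c + b * c) g"
      by (simp add: plus_hahn.rep_eq distrib_right sum.distrib)
  qed
  show "a * b * c = a * (b * c)"
  proof (rule hahn_eqI)
    fix g
    define A where "A = {g. coeff a g \<noteq> 0}"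
    define B where "B = {g. coeff b g \<noteq> 0}"
    define C where "C = {g. coeff c g \<noteq> 0}"
    have wo: "well_ordered A" "well_ordered B" "well_ordered C"
      unfolding A_def B_def C_def by simp_all
    define H where "H = {h \<in> {x + y |x y. x \<in> A \<and> y \<in> B}. g - h \<in> C}"
    define J where "J = {h \<in> A. g - h \<in> {x + y |x y. x \<in> B \<and> y \<in> C}}"
    have H: "finite H" unfolding H_def
      by (intro finite_decompositions well_ordered_sumset wo)
    have J: "finite J" unfolding J_def
      by (intro finite_decompositions well_ordered_sumset wo)
    have conv: "x \<in> A \<Longrightarrow> h - x \<in> B \<Longrightarrow> \<exists>u v. h = u + v \<and> u \<in> A \<and> v \<in> B" for x h
      by (rule exI[of _ x], rule exI[of _ "h - x"]) auto
    have conv': "x \<in> B \<Longrightarrow> h - x \<in> C \<Longrightarrow> \<exists>u v. h = u + v \<and> u \<in> B \<and> v \<in> C" for x h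
      by (rule exI[of _ x], rule exI[of _ "h - x"]) auto
    have AB: "coeff (a * b) h \<noteq> 0 \<Longrightarrow> \<exists>x. x \<in> A \<and> h - x \<in> B" for h
      unfolding times_hahn.rep_eq A_def B_def
      by (auto dest: sum_Collect_nonzeroD)
    have BC: "coeff (b * c) h \<noteq> 0 \<Longrightarrow> \<exists>x. x \<in> B \<and> h - x \<in> C" for h
      unfolding times_hahn.rep_eq B_def C_def
      by (auto dest: sum_Collect_nonzeroD)
    have finI: "finite {i. i \<in> A \<and> h - i \<in> B}" for h
      using finite_decompositions[OF wo(1,2)] by simp
    have finK: "finite {j. j \<in> B \<and> g - i - j \<in> C}" for i
      using finite_decompositions[OF wo(2,3)] by simp
    have "coeff (a * b * c) g = (\<Sum>h\<in>H. coeff (a * b) h * coeff c (g - h))"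
    proof (rule coeff_times_superset[OF H], rule subsetI)
      fix h assume "h \<in> {h. coeff (a * b) h \<noteq> 0 \<and> coeff c (g - h) \<noteq> 0}"
      then show "h \<in> H" using AB[of h] conv[of _ h] unfolding H_def C_def by blast
    qed
    also have "\<dots> = (\<Sum>h\<in>H. \<Sum>i | i \<in> A \<and> h - i \<in> B. coeff a i * coeff b (h - i) * coeff c (g - h))"
      by (simp add: times_hahn.rep_eq A_def B_def sum_distrib_right)
    also have "\<dots> = (\<Sum>(h, i)\<in>Sigma H (\<lambda>h. {i. i \<in> A \<and> h - i \<in> B}).
        coeff a i * coeff b (h - i) * coeff c (g - h))"
      by (rule sum.Sigma) (use H finI in auto)
    also have "\<dots> = (\<Sum>(i, j)\<in>Sigma J (\<lambda>i. {j. j \<in> B \<and> g - i - j \<in> C}).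
        coeff a i * (coeff b j * coeff c (g - i - j)))"
    proof (rule sum.reindex_bij_witness[of _ "\<lambda>(i, j). (i + j, i)" "\<lambda>(h, i). (i, h - i)"])
      fix p assume p: "p \<in> Sigma H (\<lambda>h. {i. i \<in> A \<and> h - i \<in> B})"
      obtain h i where hi: "p = (h, i)" by fastforce
      then show "(case case p of (h, i) \<Rightarrow> (i, h - i) of (i, j) \<Rightarrow> (i + j, i)) = p" by simp
      show "(case p of (h, i) \<Rightarrow> (i, h - i)) \<in> Sigma J (\<lambda>i. {j. j \<in> B \<and> g - i - j \<in> C})"
        using p hi conv'[of "h - i" "g - i"] unfolding J_def H_def by auto
      show "(case case p of (h, i) \<Rightarrow> (i, h - i) of (i, j) \<Rightarrow>
          coeff a i * (coeff b j * coeff c (g - i - j))) =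
        (case p of (h, i) \<Rightarrow> coeff a i * coeff b (h - i) * coeff c (g - h))"
        using hi by (simp add: mult.assoc)
    next
      fix q assume q: "q \<in> Sigma J (\<lambda>i. {j. j \<in> B \<and> g - i - j \<in> C})"
      obtain i j where ij: "q = (i, j)" by fastforce
      then show "(case case q of (i, j) \<Rightarrow> (i + j, i) of (h, i) \<Rightarrow> (i, h - i)) = q" by simp
      show "(case q of (i, j) \<Rightarrow> (i + j, i)) \<in> Sigma H (\<lambda>h. {i. i \<in> A \<and> h - i \<in> B})"
        using q ij conv[of i "i + j"] unfolding J_def H_def by (auto simp: diff_diff_eq)
    qed
    also have "\<dots> = (\<Sum>i\<in>J. \<Sum>j | j \<in> B \<and> g - i - j \<in> C.
        coeff a i * (coeff b j * coeff c (g - i - j)))"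
      by (rule sum.Sigma[symmetric]) (use J finK in auto)
    also have "\<dots> = (\<Sum>i\<in>J. coeff a i * coeff (b * c) (g - i))"
      by (simp add: times_hahn.rep_eq B_def C_def sum_distrib_left)
    also have "\<dots> = coeff (a * (b * c)) g"
    proof (rule coeff_times_superset[OF J, symmetric], rule subsetI)
      fix h assume "h \<in> {h. coeff a h \<noteq> 0 \<and> coeff (b * c) (g - h) \<noteq> 0}"
      then show "h \<in> J" using BC[of "g - h"] conv'[of _ "g - h"] unfolding J_def A_def by blast
    qed
    finally show "coeff (a * b * c) g = coeff (a * (b * c)) g" .
  qed
qed

end

definition subfield_of_series :: "('g::linordered_ab_group_add, 'k::field) hahn set \<Rightarrow> bool" where
  "subfield_of_series K \<longleftrightarrow>
     0 \<in> K \<and> 1 \<in> K \<and>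
     (\<forall>a\<in>K. \<forall>b\<in>K. a + b \<in> K) \<and> (\<forall>a\<in>K. - a \<in> K) \<and>
     (\<forall>a\<in>K. \<forall>b\<in>K. a * b \<in> K) \<and>
     (\<forall>a\<in>K. a \<noteq> 0 \<longrightarrow> (\<exists>b\<in>K. a * b = 1))"

definition group_ring :: "('g::linordered_ab_group_add, 'k::field) hahn set" where
  "group_ring = {a. finite (supp a)}"

text \<open>
  Since \<open>k((G))\<close> is a field, \<open>x * q = p\<close> with \<open>q \<noteq> 0\<close> says \<open>x = p / q\<close>, so this is \<open>k(G)\<close>.
\<close>

definition rational_series :: "('g::linordered_ab_group_add, 'k::field) hahn set" where
  "rational_series = {x. \<exists>p\<in>group_ring. \<exists>q\<in>group_ring. q \<noteq> 0 \<and> x * q = p}"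

definition hahn_field :: "('g::linordered_ab_group_add, 'k::field) hahn set \<Rightarrow> bool" where
  "hahn_field K \<longleftrightarrow> subfield_of_series K \<and> rational_series \<subseteq> K"

text \<open>
  The empty sum \<open>0\<close> is included; for non-trivial \<open>G\<close> this does not affect the notion of
  field family, since \<open>{0}\<close> then belongs to the family by the other closure conditions.
\<close>

definition finite_sums :: "'g::comm_monoid_add set \<Rightarrow> 'g set" where
  "finite_sums A = {sum_list xs |xs. set xs \<subseteq> A}"

definition field_family :: "'g::linordered_ab_group_add set set \<Rightarrow> bool" where
  "field_family \<F> \<longleftrightarrow>
     \<F> \<noteq> {} \<and>
     (\<forall>A\<in>\<F>. well_ordered A) \<and>
     group_closure (\<Union>\<F>) = UNIV \<and>
     (\<forall>A\<in>\<F>. \<forall>B\<in>\<F>. A \<union> B \<in> \<F>) \<and>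
     (\<forall>A\<in>\<F>. \<forall>B. B \<subseteq> A \<longrightarrow> B \<in> \<F>) \<and>
     (\<forall>A\<in>\<F>. \<forall>g. (\<lambda>x. x + g) ` A \<in> \<F>) \<and>
     (\<forall>A\<in>\<F>. A \<subseteq> {0..} \<longrightarrow> finite_sums A \<in> \<F>)"

definition rayner_field ::
    "'g::linordered_ab_group_add set set \<Rightarrow> ('g, 'k::field) hahn set" where
  "rayner_field \<F> = {a. supp a \<in> \<F>}"

lemma finite_sums_add: "x \<in> finite_sums A \<Longrightarrow> y \<in> finite_sums A \<Longrightarrow> x + y \<in> finite_sums A"
  unfolding finite_sums_def
  by clarify (metis set_append le_sup_iff sum_list_append)

lemma finite_sums_zero: "0 \<in> finite_sums A"
  unfolding finite_sums_def by (auto intro: exI[of _ "[]"])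

lemma finite_sums_base: "x \<in> A \<Longrightarrow> x \<in> finite_sums A"
  unfolding finite_sums_def by (auto intro!: exI[of _ "[x]"])

lemma supp_zero [simp]: "supp (0 :: ('g::linordered_ab_group_add, 'k::comm_ring_1) hahn) = {}"
  by (simp add: supp_def zero_hahn.rep_eq)

lemma supp_one_subset: "supp (1 :: ('g::linordered_ab_group_add, 'k::comm_ring_1) hahn) \<subseteq> {0}"
  by (auto simp: supp_def one_hahn.rep_eq split: if_splits)

lemma supp_add_subset: "supp (a + b) \<subseteq> supp a \<union> supp b"
  for a b :: "('g::linordered_ab_group_add, 'k::comm_ring_1) hahn"
  by (auto simp: supp_def plus_hahn.rep_eq)

lemma supp_uminus [simp]: "supp (- a) = supp a"
  for a :: "('g::linordered_ab_group_add, 'k::comm_ring_1) hahn"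
  by (auto simp: supp_def uminus_hahn.rep_eq)

lemma supp_mult_subset: "supp (a * b) \<subseteq> {x + y |x y. x \<in> supp a \<and> y \<in> supp b}"
  for a b :: "('g::linordered_ab_group_add, 'k::comm_ring_1) hahn"
proof
  fix g assume "g \<in> supp (a * b)"
  then obtain h where "coeff a h \<noteq> 0" "coeff b (g - h) \<noteq> 0"
    by (auto simp: supp_def times_hahn.rep_eq dest: sum_Collect_nonzeroD)
  moreover have "g = h + (g - h)" by simp
  ultimately show "g \<in> {x + y |x y. x \<in> supp a \<and> y \<in> supp b}"
    unfolding supp_def by blast
qed

lemma supp_eq_empty_iff: "supp a = {} \<longleftrightarrow> a = 0"
  for a :: "('g::linordered_ab_group_add, 'k::comm_ring_1) hahn"
  by (auto simp: supp_def zero_hahn.rep_eq intro: hahn_eqI)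

lift_definition hahn_monom ::
    "'k::comm_ring_1 \<Rightarrow> 'g::linordered_ab_group_add \<Rightarrow> ('g, 'k) hahn"
  is "\<lambda>c g h. if h = g then c else 0"
  by (rule well_ordered_subset[OF well_ordered_singleton]) (auto split: if_splits)

lemma coeff_monom_mult: "coeff (hahn_monom c g * a) h = c * coeff a (h - g)"
proof -
  have "coeff (hahn_monom c g * a) h = (\<Sum>i\<in>{g}. coeff (hahn_monom c g) i * coeff a (h - i))"
    by (rule coeff_times_superset) (auto simp: hahn_monom.rep_eq split: if_splits)
  then show ?thesis by (simp add: hahn_monom.rep_eq)
qed

text \<open>
  Inverse of a series with constant term \<open>1\<close> and non-negative support inside a well-ordered
  monoid \<open>S\<close>, by recursion along \<open>S\<close>.
\<close>

lemma inverse_in_monoid: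
  fixes x :: "('g::linordered_ab_group_add, 'k::field) hahn"
  assumes S: "well_ordered S" "0 \<in> S" "\<And>u v. u \<in> S \<Longrightarrow> v \<in> S \<Longrightarrow> u + v \<in> S"
    and x: "coeff x 0 = 1" "supp x \<subseteq> S" "\<And>g. g \<in> supp x \<Longrightarrow> 0 \<le> g"
  shows "\<exists>y. x * y = 1 \<and> supp y \<subseteq> S"
proof -
  define R where "R = {(u, v). u \<in> S \<and> v \<in> S \<and> u < v}"
  define N where "N g = {h. 0 < h \<and> h \<in> supp x \<and> g - h \<in> S}" for g
  define body where "body r g =
    (if g \<in> S then (if g = 0 then 1 else 0) - (\<Sum>h\<in>N g. coeff x h * r (g - h)) else 0 :: 'k)" for r g
  define f where "f = wfrec R body"
  have finN: "finite (N g)" for g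
    by (rule finite_subset[OF _ finite_decompositions[OF well_ordered_supp[of x] S(1), of g]])
      (auto simp: N_def)
  have "wf R" unfolding R_def by (rule well_ordered_wf[OF S(1)])
  have f: "f g = body f g" for g
  proof -
    have "f g = body (cut f R g) g" unfolding f_def by (rule wfrec[OF \<open>wf R\<close>])
    also have "\<dots> = body f g"
    proof (cases "g \<in> S")
      case True
      have "(\<Sum>h\<in>N g. coeff x h * cut f R g (g - h)) = (\<Sum>h\<in>N g. coeff x h * f (g - h))"
        by (rule sum.cong[OF refl]) (use True in \<open>simp add: cut_def R_def N_def\<close>)
      then show ?thesis unfolding body_def by simp
    qed (simp add: body_def)
    finally show ?thesis .
  qed
  have f_out: "f g = 0" if "g \<notin> S" for g
    using f[of g] that by (simp add: body_def)
  have fS: "{g. f g \<noteq> 0} \<subseteq> S" using f_out by blast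
  define y where "y = Abs_hahn f"
  have y: "coeff y = f"
    unfolding y_def by (rule Abs_hahn_inverse) (use well_ordered_subset[OF S(1) fS] in simp)
  have "x * y = 1"
  proof (rule hahn_eqI)
    fix g
    have "coeff (x * y) g = (\<Sum>h\<in>insert 0 (N g). coeff x h * f (g - h))"
      unfolding y[symmetric]
    proof (rule coeff_times_superset)
      show "{h. coeff x h \<noteq> 0 \<and> coeff y (g - h) \<noteq> 0} \<subseteq> insert 0 (N g)"
      proof
        fix h assume h: "h \<in> {h. coeff x h \<noteq> 0 \<and> coeff y (g - h) \<noteq> 0}"
        then have "h \<in> supp x" "g - h \<in> S" using fS by (auto simp: supp_def y)
        moreover from this have "0 \<le> h" using x(3) by blast
        ultimately show "h \<in> insert 0 (N g)" unfolding N_def by auto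
      qed
    qed (simp add: finN)
    also have "\<dots> = f g + (\<Sum>h\<in>N g. coeff x h * f (g - h))"
    proof -
      have "0 \<notin> N g" by (simp add: N_def)
      then show ?thesis by (simp add: finN x(1))
    qed
    also have "\<dots> = coeff 1 g"
    proof (cases "g \<in> S")
      case True
      then show ?thesis using f[of g] by (simp add: body_def one_hahn.rep_eq)
    next
      case False
      have "h \<notin> N g" for h
      proof
        assume "h \<in> N g"
        then have "h + (g - h) \<in> S" using S(3) x(2) unfolding N_def by blast
        then show False using False by simp
      qed
      then have "N g = {}" by blast
      moreover have "g \<noteq> 0" using False S(2) by blast
      ultimately show ?thesis using f_out[OF False] by (simp add: one_hahn.rep_eq)
    qed
    finally show "coeff (x * y) g = coeff 1 g" .
  qed
  moreover have "supp y \<subseteq> S" using fS by (simp add: supp_def y)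
  ultimately show ?thesis by blast
qed

lemma field_familyD:
  assumes "field_family \<F>"
  shows "A \<in> \<F> \<Longrightarrow> well_ordered A"
    and "group_closure (\<Union>\<F>) = UNIV"
    and "A \<in> \<F> \<Longrightarrow> B \<in> \<F> \<Longrightarrow> A \<union> B \<in> \<F>"
    and "A \<in> \<F> \<Longrightarrow> B \<subseteq> A \<Longrightarrow> B \<in> \<F>"
    and "A \<in> \<F> \<Longrightarrow> (\<lambda>x. x + g) ` A \<in> \<F>"
    and "A \<in> \<F> \<Longrightarrow> A \<subseteq> {0..} \<Longrightarrow> finite_sums A \<in> \<F>"
  using assms unfolding field_family_def by simp_all

lemma field_family_finite:
  fixes \<F> :: "'g::linordered_ab_group_add set set"
  assumes F: "field_family \<F>" and nontrivial: "\<exists>g::'g. g \<noteq> 0" and "finite A"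
  shows "A \<in> \<F>"
  using \<open>finite A\<close>
proof (induction A rule: finite_induct)
  case empty
  have "\<F> \<noteq> {}" using F by (simp add: field_family_def)
  then obtain B where "B \<in> \<F>" by blast
  then show ?case by (rule field_familyD(4)[OF F]) simp
next
  case (insert g A)
  have "\<Union>\<F> \<noteq> {}"
  proof
    assume "\<Union>\<F> = {}"
    then have "group_closure {} = (UNIV :: 'g set)" using field_familyD(2)[OF F] by (simp only:)
    then have "g \<in> {0}" for g :: 'g by (simp only: group_closure_empty UNIV_I)
    then show False using nontrivial by blast
  qed
  then obtain B b where "B \<in> \<F>" "b \<in> B" by blast
  then have "{b} \<in> \<F>" using field_familyD(4)[OF F, of B "{b}"] by simp
  then have "{g} \<in> \<F>" using field_familyD(5)[OF F, of "{b}" "g - b"] by simp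
  then show ?case using field_familyD(3)[OF F, of "{g}" A] insert.IH by simp
qed

lemma field_family_sumset:
  fixes \<F> :: "'g::linordered_ab_group_add set set"
  assumes F: "field_family \<F>" and "A \<in> \<F>" "B \<in> \<F>"
  shows "{a + b |a b. a \<in> A \<and> b \<in> B} \<in> \<F>"
proof (cases "A = {} \<or> B = {}")
  case True
  then have "{a + b |a b. a \<in> A \<and> b \<in> B} \<subseteq> A" by blast
  then show ?thesis by (rule field_familyD(4)[OF F \<open>A \<in> \<F>\<close>])
next
  case False
  obtain m where m: "m \<in> A" "\<forall>a\<in>A. m \<le> a"
    using well_ordered_least[OF field_familyD(1)[OF F \<open>A \<in> \<F>\<close>] subset_refl] False by blast
  obtain n where n: "n \<in> B" "\<forall>b\<in>B. n \<le> b"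
    using well_ordered_least[OF field_familyD(1)[OF F \<open>B \<in> \<F>\<close>] subset_refl] False by blast
  define U where "U = (\<lambda>x. x + - m) ` A \<union> (\<lambda>x. x + - n) ` B"
  have "U \<in> \<F>" unfolding U_def by (intro field_familyD(3)[OF F] field_familyD(5)[OF F] assms)
  moreover have "U \<subseteq> {0..}" using m n by (auto simp: U_def)
  ultimately have "finite_sums U \<in> \<F>" by (rule field_familyD(6)[OF F])
  then have "(\<lambda>x. x + (m + n)) ` finite_sums U \<in> \<F>" by (rule field_familyD(5)[OF F])
  moreover have "{a + b |a b. a \<in> A \<and> b \<in> B} \<subseteq> (\<lambda>x. x + (m + n)) ` finite_sums U"
  proof clarify
    fix a b assume ab: "a \<in> A" "b \<in> B"
    have "a + - m \<in> finite_sums U" "b + - n \<in> finite_sums U"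
      using ab by (auto intro!: finite_sums_base simp: U_def)
    then have "(a + - m) + (b + - n) \<in> finite_sums U" by (rule finite_sums_add)
    moreover have "a + b = (a + - m) + (b + - n) + (m + n)" by (simp add: algebra_simps)
    ultimately show "a + b \<in> (\<lambda>x. x + (m + n)) ` finite_sums U" by (rule rev_image_eqI)
  qed
  ultimately show ?thesis by (rule field_familyD(4)[OF F])
qed

theorem hahn_field_rayner_field:
  fixes \<F> :: "'g::linordered_ab_group_add set set"
  assumes F: "field_family \<F>" and nontrivial: "\<exists>g::'g. g \<noteq> 0"
  shows "hahn_field (rayner_field \<F> :: ('g, 'k::field) hahn set)"
proof -
  let ?K = "rayner_field \<F> :: ('g, 'k) hahn set"
  note fin = field_family_finite[OF F nontrivial]
  note sub = field_familyD(4)[OF F]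
  have mult: "a * b \<in> ?K" if "a \<in> ?K" "b \<in> ?K" for a b
    using sub[OF field_family_sumset[OF F] supp_mult_subset] that
    by (simp add: rayner_field_def)
  have inv: "\<exists>b\<in>?K. a * b = 1" if a: "a \<in> ?K" "a \<noteq> 0" for a
  proof -
    have A: "supp a \<in> \<F>" using a(1) by (simp add: rayner_field_def)
    have ne: "supp a \<noteq> {}" using a(2) by (simp add: supp_eq_empty_iff)
    obtain m where m: "m \<in> supp a" "\<forall>g\<in>supp a. m \<le> g"
      using well_ordered_least[OF well_ordered_supp subset_refl ne] by blast
    define c where "c = inverse (coeff a m)"
    define x where "x = hahn_monom c (- m) * a"
    have x: "coeff x h = c * coeff a (h + m)" for h
      by (simp add: x_def coeff_monom_mult)
    have suppx: "supp x \<subseteq> (\<lambda>g. g + - m) ` supp a"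
    proof
      fix h assume "h \<in> supp x"
      then have "h + m \<in> supp a" by (auto simp: supp_def x)
      moreover have "h = (h + m) + - m" by simp
      ultimately show "h \<in> (\<lambda>g. g + - m) ` supp a" by (rule rev_image_eqI)
    qed
    define T where "T = (\<lambda>g. g + - m) ` supp a"
    have T: "T \<in> \<F>" unfolding T_def by (rule field_familyD(5)[OF F A])
    have T0: "T \<subseteq> {0..}" using m(2) by (auto simp: T_def)
    have S: "finite_sums T \<in> \<F>" by (rule field_familyD(6)[OF F T T0])
    have "\<exists>y. x * y = 1 \<and> supp y \<subseteq> finite_sums T"
    proof (rule inverse_in_monoid)
      show "well_ordered (finite_sums T)" by (rule field_familyD(1)[OF F S])
      show "coeff x 0 = 1" using m(1) by (simp add: x c_def supp_def)
      show "supp x \<subseteq> finite_sums T" using suppx finite_sums_base unfolding T_def by blast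
      show "0 \<le> g" if "g \<in> supp x" for g using suppx T0 that unfolding T_def by auto
    qed (simp_all add: finite_sums_zero finite_sums_add)
    then obtain y where y: "x * y = 1" "supp y \<subseteq> finite_sums T" by blast
    have "y \<in> ?K" using sub[OF S y(2)] by (simp add: rayner_field_def)
    moreover have "hahn_monom c (- m) \<in> ?K"
      unfolding rayner_field_def
      by (auto intro!: fin finite_subset[of _ "{- m}"] simp: supp_def hahn_monom.rep_eq)
    ultimately have "hahn_monom c (- m) * y \<in> ?K" by (intro mult)
    moreover have "a * (hahn_monom c (- m) * y) = 1"
      using y(1) by (simp add: x_def ac_simps)
    ultimately show ?thesis by blast
  qed
  have "subfield_of_series ?K"
    unfolding subfield_of_series_def
  proof (intro conjI ballI impI)
    show "0 \<in> ?K" using fin[of "{}"] by (simp add: rayner_field_def)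
    show "1 \<in> ?K" using sub[OF fin[of "{0}"] supp_one_subset] by (simp add: rayner_field_def)
    show "a + b \<in> ?K" if "a \<in> ?K" "b \<in> ?K" for a b
      using sub[OF field_familyD(3)[OF F] supp_add_subset] that by (simp add: rayner_field_def)
    show "- a \<in> ?K" if "a \<in> ?K" for a using that by (simp add: rayner_field_def)
  qed (use mult inv in auto)
  moreover have "rational_series \<subseteq> ?K"
  proof
    fix x :: "('g, 'k) hahn" assume "x \<in> rational_series"
    then obtain p q where pq: "p \<in> group_ring" "q \<in> group_ring" "q \<noteq> 0" "x * q = p"
      unfolding rational_series_def by blast
    have pqK: "p \<in> ?K" "q \<in> ?K"
      using pq(1,2) fin by (simp_all add: group_ring_def rayner_field_def)
    obtain r where r: "r \<in> ?K" "q * r = 1" using inv[OF pqK(2) pq(3)] by blast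
    have "x = x * (q * r)" by (simp add: r(2))
    also have "\<dots> = p * r" using pq(4) by (simp add: mult.assoc[symmetric])
    finally show "x \<in> ?K" using mult[OF pqK(1) r(1)] by simp
  qed
  ultimately show ?thesis by (simp add: hahn_field_def)
qed

definition field_automorphism :: "('k::field \<Rightarrow> 'k) \<Rightarrow> bool" where
  "field_automorphism \<rho> \<longleftrightarrow>
     bij \<rho> \<and> \<rho> 1 = 1 \<and> (\<forall>x y. \<rho> (x + y) = \<rho> x + \<rho> y) \<and> (\<forall>x y. \<rho> (x * y) = \<rho> x * \<rho> y)"

definition order_automorphism :: "('g::linordered_ab_group_add \<Rightarrow> 'g) \<Rightarrow> bool" where
  "order_automorphism \<tau> \<longleftrightarrow>
     bij \<tau> \<and> (\<forall>x y. \<tau> (x + y) = \<tau> x + \<tau> y) \<and> (\<forall>x y. x < y \<longrightarrow> \<tau> x < \<tau> y)"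

text \<open>
  The coefficient of \<open>t\<^sup>g\<close> in \<open>\<Sum>\<rho>(a\<^sub>h) t\<^bsup>\<tau>(h)\<^esup>\<close> is that of \<open>h = \<tau>\<^sup>-\<^sup>1(g)\<close>; only
  meaningful for automorphisms \<open>\<rho>\<close> and \<open>\<tau>\<close>, see \<open>coeff_canonical_lift\<close>.
\<close>

definition canonical_lift ::
    "('k::field \<Rightarrow> 'k) \<Rightarrow> ('g::linordered_ab_group_add \<Rightarrow> 'g) \<Rightarrow> ('g, 'k) hahn \<Rightarrow> ('g, 'k) hahn" where
  "canonical_lift \<rho> \<tau> a = Abs_hahn (\<lambda>g. \<rho> (coeff a (inv \<tau> g)))"

lemma coeff_canonical_lift:
  assumes \<rho>: "field_automorphism \<rho>" and \<tau>: "order_automorphism \<tau>"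
  shows "coeff (canonical_lift \<rho> \<tau> a) (\<tau> g) = \<rho> (coeff a g)"
proof -
  have bij: "bij \<tau>" and mono: "x < y \<Longrightarrow> \<tau> x < \<tau> y" for x y
    using \<tau> by (simp_all add: order_automorphism_def)
  have "\<rho> (0 + 0) = \<rho> 0 + \<rho> 0" using \<rho> unfolding field_automorphism_def by blast
  then have "\<rho> 0 + 0 = \<rho> 0 + \<rho> 0" by (simp only: add_0_right)
  then have zero: "\<rho> 0 = 0" by (simp only: add_left_cancel)
  have surj: "\<tau> (inv \<tau> x) = x" for x
    using bij by (simp add: bij_is_surj surj_f_inv_f)
  have inv_mono: "x \<le> y" if "inv \<tau> x \<le> inv \<tau> y" for x y
  proof (cases "inv \<tau> x = inv \<tau> y")
    case True
    then have "\<tau> (inv \<tau> x) = \<tau> (inv \<tau> y)" by (rule arg_cong)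
    then show ?thesis by (simp add: surj)
  next
    case False
    then have "\<tau> (inv \<tau> x) < \<tau> (inv \<tau> y)" using that by (intro mono) simp
    then show ?thesis by (simp add: surj)
  qed
  have "well_ordered {g. \<rho> (coeff a (inv \<tau> g)) \<noteq> 0}"
    unfolding well_ordered_def
  proof (intro allI impI)
    fix B assume B: "B \<subseteq> {g. \<rho> (coeff a (inv \<tau> g)) \<noteq> 0}" "B \<noteq> {}"
    have "inv \<tau> ` B \<subseteq> supp a" using B(1) zero by (auto simp: supp_def)
    then have "\<exists>m\<in>inv \<tau> ` B. \<forall>b\<in>inv \<tau> ` B. m \<le> b"
      by (rule well_ordered_least[OF well_ordered_supp]) (use B(2) in simp)
    then show "\<exists>m\<in>B. \<forall>b\<in>B. m \<le> b" using inv_mono by blast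
  qed
  then have "coeff (canonical_lift \<rho> \<tau> a) = (\<lambda>g. \<rho> (coeff a (inv \<tau> g)))"
    unfolding canonical_lift_def by (intro Abs_hahn_inverse) simp
  then show ?thesis using bij by (simp add: bij_is_inj)
qed

text \<open>
  A property of Hahn fields, hence the first conjunct; for Rayner fields it holds by
  \<open>hahn_field_rayner_field\<close>.
\<close>

definition canonical_first_lifting_property ::
    "('g::linordered_ab_group_add, 'k::field) hahn set \<Rightarrow> bool" where
  "canonical_first_lifting_property K \<longleftrightarrow>
     hahn_field K \<and>
     (\<forall>\<rho> \<tau>. field_automorphism \<rho> \<longrightarrow> order_automorphism \<tau> \<longrightarrow> canonical_lift \<rho> \<tau> ` K = K)"

end

theory Submission
  imports Defs
begin

text \<open>
  Since a field automorphism kills only \<open>0\<close>, the canonical lift of \<open>(\<rho>, \<tau>)\<close> moves the support of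
  a series by \<open>\<tau>\<close> and by nothing else (\<open>supp_canonical_lift\<close>). Membership in the Rayner field
  depends on the support only, so stability of \<open>\<F>\<close> makes every lift map the Rayner field into
  itself; it is onto because the lift of \<open>(\<rho>\<^sup>-\<^sup>1, \<tau>\<^sup>-\<^sup>1)\<close> is a right inverse which, by the same
  stability, also respects the Rayner field. Conversely, every well-ordered set is the support of
  some series (\<open>ex_supp_eq\<close>), so stability of \<open>\<F>\<close> under \<open>\<tau>\<close> can be read off from the lifts of
  \<open>(id, \<tau>)\<close>.
\<close>

lemma field_automorphism_eq_0_iff:
  assumes "field_automorphism \<rho>"
  shows "\<rho> x = 0 \<longleftrightarrow> x = 0"
proof -
  have "\<rho> (0 + 0) = \<rho> 0 + \<rho> 0"
    using assms unfolding field_automorphism_def by blast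
  then have "\<rho> 0 = 0" by (simp only: add_0_right add_cancel_right_right)
  moreover have "inj \<rho>" using assms by (simp add: field_automorphism_def bij_is_inj)
  ultimately show ?thesis by (metis injD)
qed

lemma field_automorphism_id: "field_automorphism (id :: 'k::field \<Rightarrow> 'k)"
  by (simp add: field_automorphism_def)

lemma field_automorphism_inv:
  assumes "field_automorphism \<rho>"
  shows "field_automorphism (inv \<rho>)"
proof -
  have bij: "bij \<rho>" and one: "\<rho> 1 = 1"
    and add: "\<And>x y. \<rho> (x + y) = \<rho> x + \<rho> y" and mult: "\<And>x y. \<rho> (x * y) = \<rho> x * \<rho> y"
    using assms by (simp_all add: field_automorphism_def)
  have eqI: "inv \<rho> y = x" if "\<rho> x = y" for x y
    using that bij by (auto simp: bij_is_inj)
  have \<rho>_inv: "\<rho> (inv \<rho> y) = y" for y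
    using bij by (simp add: bij_is_surj surj_f_inv_f)
  show ?thesis
    unfolding field_automorphism_def
    by (intro conjI allI eqI) (simp_all add: bij bij_imp_bij_inv one add mult \<rho>_inv)
qed

text \<open>Linearity of the order is what makes the inverse of an increasing bijection increasing.\<close>

lemma order_automorphism_inv:
  assumes "order_automorphism \<tau>"
  shows "order_automorphism (inv \<tau>)"
proof -
  have bij: "bij \<tau>" and add: "\<And>x y. \<tau> (x + y) = \<tau> x + \<tau> y"
    and mono: "\<And>x y. x < y \<Longrightarrow> \<tau> x < \<tau> y"
    using assms by (simp_all add: order_automorphism_def)
  have eqI: "inv \<tau> y = x" if "\<tau> x = y" for x y
    using that bij by (auto simp: bij_is_inj)
  have \<tau>_inv: "\<tau> (inv \<tau> y) = y" for y
    using bij by (simp add: bij_is_surj surj_f_inv_f)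
  have "inv \<tau> x < inv \<tau> y" if "x < y" for x y
  proof (rule ccontr)
    assume "\<not> inv \<tau> x < inv \<tau> y"
    then have "\<tau> (inv \<tau> y) \<le> \<tau> (inv \<tau> x)"
      using mono by (metis less_le linorder_not_less order.refl)
    then show False using that by (simp add: \<tau>_inv)
  qed
  moreover have "inv \<tau> (x + y) = inv \<tau> x + inv \<tau> y" for x y
    by (rule eqI) (simp add: add \<tau>_inv)
  ultimately show ?thesis
    by (simp add: order_automorphism_def bij bij_imp_bij_inv)
qed

lemma supp_canonical_lift:
  assumes \<rho>: "field_automorphism \<rho>" and \<tau>: "order_automorphism \<tau>"
  shows "supp (canonical_lift \<rho> \<tau> a) = \<tau> ` supp a"
proof -
  have "\<tau> g \<in> supp (canonical_lift \<rho> \<tau> a) \<longleftrightarrow> g \<in> supp a" for g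
    by (simp add: supp_def coeff_canonical_lift[OF \<rho> \<tau>] field_automorphism_eq_0_iff[OF \<rho>])
  moreover have "surj \<tau>" using \<tau> by (simp add: order_automorphism_def bij_is_surj)
  ultimately show ?thesis by (metis image_vimage_eq Int_UNIV_right subsetI subset_antisym vimage_eq)
qed

lemma canonical_lift_inv:
  assumes \<rho>: "field_automorphism \<rho>" and \<tau>: "order_automorphism \<tau>"
  shows "canonical_lift \<rho> \<tau> (canonical_lift (inv \<rho>) (inv \<tau>) b) = b"
proof (rule hahn_eqI)
  fix h
  let ?a = "canonical_lift (inv \<rho>) (inv \<tau>) b"
  have surj: "surj \<rho>" "surj \<tau>"
    using \<rho> \<tau> by (simp_all add: field_automorphism_def order_automorphism_def bij_is_surj)
  have "coeff (canonical_lift \<rho> \<tau> ?a) (\<tau> (inv \<tau> h)) = \<rho> (coeff ?a (inv \<tau> h))"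
    by (rule coeff_canonical_lift[OF \<rho> \<tau>])
  also have "coeff ?a (inv \<tau> h) = inv \<rho> (coeff b h)"
    by (intro coeff_canonical_lift field_automorphism_inv order_automorphism_inv \<rho> \<tau>)
  finally show "coeff (canonical_lift \<rho> \<tau> ?a) h = coeff b h"
    by (simp add: surj surj_f_inv_f)
qed

lemma ex_supp_eq:
  assumes "well_ordered A"
  shows "\<exists>a :: ('g::linordered_ab_group_add, 'k::field) hahn. supp a = A"
proof -
  let ?f = "\<lambda>g. if g \<in> A then 1 else 0 :: 'k"
  have "coeff (Abs_hahn ?f) = ?f"
    by (rule Abs_hahn_inverse) (use assms in simp)
  then have "supp (Abs_hahn ?f) = A" by (simp add: supp_def)
  then show ?thesis ..
qed

theorem proposition3p6p6:
  fixes \<F> :: "'g::linordered_ab_group_add set set"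
    and F :: "('g, 'k::field) hahn set"
  assumes "\<exists>g::'g. g \<noteq> 0"
    and "field_family \<F>"
    and "F = rayner_field \<F>"
  shows "canonical_first_lifting_property F \<longleftrightarrow>
    (\<forall>A \<tau>. A \<in> \<F> \<longrightarrow> order_automorphism \<tau> \<longrightarrow> \<tau> ` A \<in> \<F>)"
proof
  have mem: "a \<in> F \<longleftrightarrow> supp a \<in> \<F>" for a
    by (simp add: assms(3) rayner_field_def)
  {
    assume lifting: "canonical_first_lifting_property F"
    show "\<forall>A \<tau>. A \<in> \<F> \<longrightarrow> order_automorphism \<tau> \<longrightarrow> \<tau> ` A \<in> \<F>"
    proof (intro allI impI)
      fix A and \<tau> :: "'g \<Rightarrow> 'g"
      assume A: "A \<in> \<F>" and \<tau>: "order_automorphism \<tau>"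
      obtain a :: "('g, 'k) hahn" where a: "supp a = A"
        using ex_supp_eq[OF field_familyD(1)[OF assms(2) A]] by blast
      have "canonical_lift id \<tau> ` F = F"
        using lifting field_automorphism_id[where 'k = 'k] \<tau>
        by (simp add: canonical_first_lifting_property_def)
      moreover have "a \<in> F" by (simp add: mem a A)
      ultimately have "canonical_lift id \<tau> a \<in> F" by blast
      then show "\<tau> ` A \<in> \<F>"
        by (simp add: mem supp_canonical_lift[OF field_automorphism_id \<tau>] a)
    qed
  next
    assume stable: "\<forall>A \<tau>. A \<in> \<F> \<longrightarrow> order_automorphism \<tau> \<longrightarrow> \<tau> ` A \<in> \<F>"
    have into: "canonical_lift \<rho> \<tau> a \<in> F"
      if "field_automorphism \<rho>" "order_automorphism \<tau>" "a \<in> F" for \<rho> \<tau> a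
      using that stable by (simp add: mem supp_canonical_lift)
    have "canonical_lift \<rho> \<tau> ` F = F"
      if \<rho>: "field_automorphism \<rho>" and \<tau>: "order_automorphism \<tau>" for \<rho> \<tau>
    proof
      show "canonical_lift \<rho> \<tau> ` F \<subseteq> F" using into[OF \<rho> \<tau>] by blast
      show "F \<subseteq> canonical_lift \<rho> \<tau> ` F"
      proof
        fix b assume "b \<in> F"
        then have "canonical_lift (inv \<rho>) (inv \<tau>) b \<in> F"
          by (intro into field_automorphism_inv order_automorphism_inv \<rho> \<tau>)
        then show "b \<in> canonical_lift \<rho> \<tau> ` F"
          using canonical_lift_inv[OF \<rho> \<tau>, of b] by (metis imageI)
      qed
    qed
    moreover have "hahn_field F"
      unfolding assms(3) by (rule hahn_field_rayner_field[OF assms(2,1)])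
    ultimately show "canonical_first_lifting_property F"
      by (simp add: canonical_first_lifting_property_def)
  }
qed

end
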